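(* Let $f\in C^3(\mathbb{R}^d)$, $d\ge2$, and fix $k\in\{0,\dots,d\}$. Suppose all critical points of $f$ are non-degenerate. Then a point $\bar{\mathbf{x}}\in\mathbb{R}^d$ is a fixed point of the index-$k$ cubic regularization method if and only if $\bar{\mathbf{x}}$ is an index-$k$ critical point of $f$. Here $\bar{\mathbf{x}}$ is called a fixed point if the zero step $\mathbf{s}=\mathbf{0}$ is a global minimizer over $\mathbf{s}\in\mathbb{R}^d$ of the cubic subproblem at $\bar{\mathbf{x}}$, $$q(\mathbf{s})=f(\bar{\mathbf{x}})+\mathbf{r}^\top\mathbf{s}+\frac12\mathbf{s}^\top B\mathbf{s}+\frac{\sigma}{3}\|\mathbf{s}\|_2^3,$$ where $\sigma>0$, $\mathbf{r}=\left(\mathbf{I}-\sum_{i=1}^k2\mathbf{v}_i\mathbf{v}_i^\top\right)\nabla f(\bar{\mathbf{x}})$, $B=\mathrm{sym}\left(\left(\mathbf{I}-\sum_{i=1}^k2\mathbf{v}_i\mathbf{v}_i^\top\right)\nabla^2 f(\bar{\mathbf{x}})\right)$, and $\mathbf{v}_1,\dots,\mathbf{v}_k$ are orthonormal eigenvectors of $\nabla^2 f(\bar{\mathbf{x}})$ associated with its $k$ smallest eigenvalues.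
   Context: Standing assumption of the paper: $f\in C^3(\mathbb{R}^d)$ with $d\ge2$, having finitely many non-degenerate critical points. $\mathrm{sym}(A)=\frac12(A+A^\top)$; $\mathbf{I}$ is the identity matrix; $\|\cdot\|_2$ is the Euclidean norm. A critical point is a point where $\nabla f$ vanishes; it is non-degenerate if the Hessian there is nonsingular, and it is an index-$k$ critical point if the Hessian there has exactly $k$ negative eigenvalues (with multiplicity). The "$k$ smallest eigenvalues" are counted with multiplicity; the choice of the orthonormal eigenvectors $\mathbf{v}_i$ and of $\sigma>0$ is arbitrary but fixed. The index-$k$ cubic regularization method is the iteration that, from the current point $\mathbf{x}$, forms the cubic subproblem as in the claim with $\bar{\mathbf{x}}$ replaced by $\mathbf{x}$, takes a global minimizer $\mathbf{s}$ of it, and moves to $\mathbf{x}+\mathbf{s}$. *)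

theory Defs
  imports "HOL-Analysis.Analysis" "HOL-Library.Multiset"
begin

section \<open>Derivatives of functions on Euclidean space\<close>

definition partial_deriv :: "'n::finite \<Rightarrow> (real^'n \<Rightarrow> real) \<Rightarrow> real^'n \<Rightarrow> real" where
  "partial_deriv i f x = frechet_derivative f (at x) (axis i 1)"

primrec C_k :: "nat \<Rightarrow> (real^'n::finite \<Rightarrow> real) \<Rightarrow> bool" where
  "C_k 0 f \<longleftrightarrow> continuous_on UNIV f"
| "C_k (Suc m) f \<longleftrightarrow> (\<forall>x. f differentiable (at x)) \<and> (\<forall>i. C_k m (partial_deriv i f))"

definition gradient :: "(real^'n::finite \<Rightarrow> real) \<Rightarrow> real^'n \<Rightarrow> real^'n" where
  "gradient f x = (\<chi> i. partial_deriv i f x)"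

definition hessian :: "(real^'n::finite \<Rightarrow> real) \<Rightarrow> real^'n \<Rightarrow> real^'n^'n" where
  "hessian f x = jacobian (gradient f) (at x)"


section \<open>Eigenvalues with multiplicity\<close>

definition eigenspace :: "real^'n::finite^'n \<Rightarrow> real \<Rightarrow> (real^'n) set" where
  "eigenspace A \<mu> = {v. A *v v = \<mu> *\<^sub>R v}"

definition real_spectrum :: "real^'n::finite^'n \<Rightarrow> real set" where
  "real_spectrum A = {\<mu>. \<exists>v. v \<noteq> 0 \<and> v \<in> eigenspace A \<mu>}"

text \<open>
  Multiplicity is the dimension of the eigenspace. For symmetric matrices, the only ones to
  which this is applied below (Hessians of \<open>C\<^sup>3\<close> functions), it agrees with the
  algebraic multiplicity, and the list has length \<open>CARD('n)\<close>.
\<close>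
definition eigenvalue_mset :: "real^'n::finite^'n \<Rightarrow> real multiset" where
  "eigenvalue_mset A = (\<Sum>\<mu>\<in>real_spectrum A. replicate_mset (dim (eigenspace A \<mu>)) \<mu>)"

definition eigenvalue_list :: "real^'n::finite^'n \<Rightarrow> real list" where
  "eigenvalue_list A = sorted_list_of_multiset (eigenvalue_mset A)"

text \<open>The vectors \<open>v\<^sub>1, \<dots>, v\<^sub>k\<close> are numbered \<open>v 0, \<dots>, v (k - 1)\<close> here; the values of \<open>v\<close>
  at other indices are irrelevant. The eigenvalue list is in increasing order.\<close>
definition smallest_orthonormal_eigenvectors ::
    "real^'n::finite^'n \<Rightarrow> nat \<Rightarrow> (nat \<Rightarrow> real^'n) \<Rightarrow> bool" where
  "smallest_orthonormal_eigenvectors A k v \<longleftrightarrow>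
     (\<forall>i<k. \<forall>j<k. v i \<bullet> v j = (if i = j then 1 else 0)) \<and>
     (\<forall>i<k. A *v v i = (eigenvalue_list A ! i) *\<^sub>R v i)"


section \<open>Critical points\<close>

definition critical_point :: "(real^'n::finite \<Rightarrow> real) \<Rightarrow> real^'n \<Rightarrow> bool" where
  "critical_point f x \<longleftrightarrow> gradient f x = 0"

definition nondegenerate :: "(real^'n::finite \<Rightarrow> real) \<Rightarrow> real^'n \<Rightarrow> bool" where
  "nondegenerate f x \<longleftrightarrow> invertible (hessian f x)"

definition index_critical_point :: "nat \<Rightarrow> (real^'n::finite \<Rightarrow> real) \<Rightarrow> real^'n \<Rightarrow> bool" where
  "index_critical_point k f x \<longleftrightarrow>
     critical_point f x \<and> size {#\<mu> \<in># eigenvalue_mset (hessian f x). \<mu> < 0#} = k"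


section \<open>The index-k cubic regularization method\<close>

definition outer_product :: "real^'n::finite \<Rightarrow> real^'n \<Rightarrow> real^'n^'n" where
  "outer_product u w = (\<chi> i j. u $ i * w $ j)"

definition sym_part :: "real^'n::finite^'n \<Rightarrow> real^'n^'n" where
  "sym_part A = (1/2) *\<^sub>R (A + transpose A)"

definition reflection :: "nat \<Rightarrow> (nat \<Rightarrow> real^'n::finite) \<Rightarrow> real^'n^'n" where
  "reflection k v = mat 1 - (\<Sum>i<k. 2 *\<^sub>R outer_product (v i) (v i))"

definition cubic_model ::
    "nat \<Rightarrow> real \<Rightarrow> (nat \<Rightarrow> real^'n::finite) \<Rightarrow> (real^'n \<Rightarrow> real) \<Rightarrow> real^'n \<Rightarrow> real^'n \<Rightarrow> real" where
  "cubic_model k \<sigma> v f x s =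
     (let r = reflection k v *v gradient f x;
          B = sym_part (reflection k v ** hessian f x)
      in f x + r \<bullet> s + 1/2 * (s \<bullet> (B *v s)) + \<sigma>/3 * norm s ^ 3)"

definition cubic_reg_fixed_point ::
    "nat \<Rightarrow> real \<Rightarrow> (nat \<Rightarrow> real^'n::finite) \<Rightarrow> (real^'n \<Rightarrow> real) \<Rightarrow> real^'n \<Rightarrow> bool" where
  "cubic_reg_fixed_point k \<sigma> v f x \<longleftrightarrow> is_arg_min (cubic_model k \<sigma> v f x) (\<lambda>_. True) 0"

end

theory Submission
  imports Defs
begin

text \<open>
  Let \<open>R\<close> be the reflection, \<open>H\<close> the Hessian and \<open>g\<close> the gradient. The first and second order
  terms of the model dominate near \<open>0\<close> and the cubic term is nonnegative, so \<open>0\<close> is a global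
  minimizer iff \<open>R g = 0\<close> and the symmetric part of \<open>R H\<close> is positive semidefinite. As \<open>R\<close> is
  injective, the former says that the point is critical, whence \<open>H\<close> is invertible. On the span of
  the \<open>v\<^sub>i\<close> the form of \<open>R H\<close> is minus that of \<open>H\<close>, on its orthogonal complement it equals that
  of \<open>H\<close>; hence it is semidefinite iff the \<open>v\<^sub>i\<close> span the sum \<open>N\<close> of the negative eigenspaces,
  whose dimension is the index. Instead of the spectral theorem, only an eigenvector minimizing
  the Rayleigh quotient on an invariant subspace is needed: on the complement of \<open>N\<close> it shows
  that \<open>H\<close> is nonnegative, and if \<open>dim N > k\<close>, it yields a negative eigenvector orthogonal to all
  \<open>v\<^sub>i\<close>.
\<close>

section \<open>Symmetry of the Hessian\<close>

lemma has_real_derivative_along_axis: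
  fixes f :: "real^'n \<Rightarrow> real"
  assumes "f differentiable (at (x + t *\<^sub>R axis i 1))"
  shows "((\<lambda>t. f (x + t *\<^sub>R axis i 1)) has_real_derivative partial_deriv i f (x + t *\<^sub>R axis i 1)) (at t)"
proof -
  let ?D = "frechet_derivative f (at (x + t *\<^sub>R axis i 1))"
  have D: "(f has_derivative ?D) (at (x + t *\<^sub>R axis i 1))"
    using assms by (simp add: frechet_derivative_works)
  have "((\<lambda>t. x + t *\<^sub>R axis i 1) has_derivative (\<lambda>h. h *\<^sub>R axis i 1)) (at t)"
    by (auto intro!: derivative_eq_intros)
  from has_derivative_compose[OF this D]
  have "((\<lambda>t. f (x + t *\<^sub>R axis i 1)) has_derivative (\<lambda>h. ?D (h *\<^sub>R axis i 1))) (at t)" .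
  moreover have "?D (h *\<^sub>R axis i 1) = partial_deriv i f (x + t *\<^sub>R axis i 1) * h" for h
    by (simp add: linear_cmul[OF linear_frechet_derivative[OF assms]] partial_deriv_def)
  ultimately show ?thesis
    by (simp add: has_field_derivative_def)
qed

text \<open>The second difference is an increment in direction \<open>i\<close> of increments in
  direction \<open>j\<close>. The mean value theorem handles the outer increment first, producing
  \<open>s\<close>, and then the remaining increment of \<open>partial_deriv i f\<close>, producing
  \<open>t\<close>.\<close>

lemma second_difference_mvt:
  fixes f :: "real^'n \<Rightarrow> real"
  assumes f: "\<And>x. f differentiable (at x)"
    and g: "\<And>x. partial_deriv i f differentiable (at x)"
    and "h > 0"
  obtains s t where "0 < s" "s < h" "0 < t" "t < h"
    "f (x + h *\<^sub>R axis i 1 + h *\<^sub>R axis j 1) - f (x + h *\<^sub>R axis i 1) - f (x + h *\<^sub>R axis j 1) + f x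
      = h * h * partial_deriv j (partial_deriv i f) (x + s *\<^sub>R axis i 1 + t *\<^sub>R axis j 1)"
proof -
  let ?a = "axis i 1 :: real^'n" and ?b = "axis j 1 :: real^'n"
  let ?g = "partial_deriv i f"
  have "((\<lambda>s. f (x + h *\<^sub>R ?b + s *\<^sub>R ?a) - f (x + s *\<^sub>R ?a)) has_real_derivative
      ?g (x + h *\<^sub>R ?b + s *\<^sub>R ?a) - ?g (x + s *\<^sub>R ?a)) (at s)" for s
    by (intro DERIV_diff has_real_derivative_along_axis f)
  from MVT2[OF \<open>h > 0\<close>, of "\<lambda>s. f (x + h *\<^sub>R ?b + s *\<^sub>R ?a) - f (x + s *\<^sub>R ?a)", OF this]
  obtain s where s: "0 < s" "s < h"
    "f (x + h *\<^sub>R ?b + h *\<^sub>R ?a) - f (x + h *\<^sub>R ?a) - (f (x + h *\<^sub>R ?b) - f x)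
       = h * (?g (x + h *\<^sub>R ?b + s *\<^sub>R ?a) - ?g (x + s *\<^sub>R ?a))"
    by auto
  from MVT2[OF \<open>h > 0\<close>, of "\<lambda>t. ?g (x + s *\<^sub>R ?a + t *\<^sub>R ?b)",
      OF has_real_derivative_along_axis[OF g]]
  obtain t where t: "0 < t" "t < h"
    "?g (x + s *\<^sub>R ?a + h *\<^sub>R ?b) - ?g (x + s *\<^sub>R ?a)
       = h * partial_deriv j ?g (x + s *\<^sub>R ?a + t *\<^sub>R ?b)"
    by auto
  show thesis
    using that[OF s(1,2) t(1,2)] s(3) t(3) by (simp add: algebra_simps)
qed

text \<open>The second difference is symmetric in \<open>i\<close> and \<open>j\<close>, so after
  division by \<open>h * h\<close> it is a value of either mixed derivative at points near
  \<open>x\<close>. Continuity at \<open>x\<close> then forces the two to agree.\<close>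

lemma mixed_partial_derivs_commute:
  fixes f :: "real^'n \<Rightarrow> real"
  assumes f: "\<And>x. f differentiable (at x)"
    and i: "\<And>x. partial_deriv i f differentiable (at x)"
    and j: "\<And>x. partial_deriv j f differentiable (at x)"
    and ij: "continuous_on UNIV (partial_deriv j (partial_deriv i f))"
    and ji: "continuous_on UNIV (partial_deriv i (partial_deriv j f))"
  shows "partial_deriv j (partial_deriv i f) x = partial_deriv i (partial_deriv j f) x"
proof (rule ccontr)
  let ?a = "axis i 1 :: real^'n" and ?b = "axis j 1 :: real^'n"
  let ?F = "partial_deriv j (partial_deriv i f)" and ?G = "partial_deriv i (partial_deriv j f)"
  assume ne: "?F x \<noteq> ?G x"
  \<comment> \<open>Half the gap: one number cannot be closer than \<open>e\<close> to both
    \<open>?F x\<close> and \<open>?G x\<close>.\<close>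
  define e where "e = \<bar>?F x - ?G x\<bar> / 2"
  have "e > 0" using ne by (simp add: e_def)
  have "isCont ?F x" "isCont ?G x"
    using ij ji by (simp_all add: continuous_on_eq_continuous_at)
  then obtain d1 d2 where d: "d1 > 0" "d2 > 0"
    "\<And>y. dist y x < d1 \<Longrightarrow> dist (?F y) (?F x) < e"
    "\<And>y. dist y x < d2 \<Longrightarrow> dist (?G y) (?G x) < e"
    using \<open>e > 0\<close> unfolding continuous_at_eps_delta dist_norm by metis
  \<comment> \<open>The intermediate points lie within \<open>p + q < 2 * h\<close> of
    \<open>x\<close>, hence the factor one half.\<close>
  define h where "h = min d1 d2 / 2"
  have "h > 0" using d by (simp add: h_def)
  obtain s t where st: "0 < s" "s < h" "0 < t" "t < h"
    "f (x + h *\<^sub>R ?a + h *\<^sub>R ?b) - f (x + h *\<^sub>R ?a) - f (x + h *\<^sub>R ?b) + f x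
      = h * h * ?F (x + s *\<^sub>R ?a + t *\<^sub>R ?b)"
    by (rule second_difference_mvt[OF f i \<open>h > 0\<close>])
  obtain s' t' where st': "0 < s'" "s' < h" "0 < t'" "t' < h"
    "f (x + h *\<^sub>R ?b + h *\<^sub>R ?a) - f (x + h *\<^sub>R ?b) - f (x + h *\<^sub>R ?a) + f x
      = h * h * ?G (x + s' *\<^sub>R ?b + t' *\<^sub>R ?a)"
    by (rule second_difference_mvt[OF f j \<open>h > 0\<close>])
  have close: "dist (x + p *\<^sub>R axis k 1 + q *\<^sub>R axis l 1) x < min d1 d2"
    if "0 < p" "p < h" "0 < q" "q < h" for p q :: real and k l :: 'n
  proof -
    have "dist (x + p *\<^sub>R axis k 1 + q *\<^sub>R axis l 1) x = norm (p *\<^sub>R axis k 1 + q *\<^sub>R axis l 1 :: real^'n)"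
      by (simp add: dist_norm add.assoc)
    also have "\<dots> \<le> p + q"
      using norm_triangle_ineq[of "p *\<^sub>R axis k 1" "q *\<^sub>R axis l 1 :: real^'n"] that
      by simp
    finally show ?thesis using that by (simp add: h_def)
  qed
  have "h * h * ?F (x + s *\<^sub>R ?a + t *\<^sub>R ?b) = h * h * ?G (x + s' *\<^sub>R ?b + t' *\<^sub>R ?a)"
    using st(5) st'(5) by (simp add: algebra_simps)
  then have "?F (x + s *\<^sub>R ?a + t *\<^sub>R ?b) = ?G (x + s' *\<^sub>R ?b + t' *\<^sub>R ?a)"
    using \<open>h > 0\<close> by simp
  moreover have "dist (?F (x + s *\<^sub>R ?a + t *\<^sub>R ?b)) (?F x) < e"
    using close[OF st(1-4), of i j] by (intro d) auto
  moreover have "dist (?G (x + s' *\<^sub>R ?b + t' *\<^sub>R ?a)) (?G x) < e"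
    using close[OF st'(1-4), of j i] by (intro d) auto
  ultimately show False
    by (auto simp: dist_real_def e_def abs_if field_simps split: if_splits)
qed

lemma hessian_component:
  fixes f :: "real^'n \<Rightarrow> real"
  assumes "\<And>i. partial_deriv i f differentiable (at x)"
  shows "hessian f x $ i $ j = partial_deriv j (partial_deriv i f) x"
proof -
  let ?D = "\<lambda>i. frechet_derivative (partial_deriv i f) (at x)"
  have D: "(partial_deriv i f has_derivative ?D i) (at x)" for i
    using assms[of i] frechet_derivative_works[of "partial_deriv i f" "at x"] by blast
  have "((\<lambda>y. \<chi> i. partial_deriv i f y) has_derivative (\<lambda>h. \<chi> i. ?D i h)) (at x)"
    unfolding has_derivative_componentwise_within[where f = "\<lambda>y. \<chi> i. partial_deriv i f y"]
  proof
    fix b :: "real^'n" assume "b \<in> Basis"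
    then obtain i where b: "b = axis i 1" by (auto simp: Basis_vec_def)
    show "((\<lambda>y. (\<chi> i. partial_deriv i f y) \<bullet> b) has_derivative (\<lambda>h. (\<chi> i. ?D i h) \<bullet> b)) (at x)"
      unfolding b inner_axis using D[of i] by simp
  qed
  then have "(gradient f has_derivative (\<lambda>h. \<chi> i. ?D i h)) (at x)"
    unfolding gradient_def .
  from frechet_derivative_at[OF this, symmetric] show ?thesis
    unfolding hessian_def jacobian_def by (simp add: matrix_def partial_deriv_def)
qed

lemma hessian_symmetric:
  fixes f :: "real^'n \<Rightarrow> real"
  assumes "C_k 2 f"
  shows "transpose (hessian f x) = hessian f x"
proof -
  have diff: "f differentiable (at y)" "partial_deriv i f differentiable (at y)"
    and cont: "continuous_on UNIV (partial_deriv j (partial_deriv i f))" for i j y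
    using assms by (auto simp: numeral_2_eq_2)
  have "hessian f x $ j $ i = hessian f x $ i $ j" for i j
    unfolding hessian_component[OF diff(2)]
    by (rule mixed_partial_derivs_commute[OF diff(1) diff(2) diff(2) cont cont])
  then show ?thesis
    by (simp add: vec_eq_iff transpose_def)
qed


section \<open>Invariant subspaces of symmetric matrices\<close>

lemma symmetric_matrix_inner:
  fixes A :: "real^'n^'n"
  assumes "transpose A = A"
  shows "(A *v x) \<bullet> y = x \<bullet> (A *v y)"
  by (metis assms dot_lmul_matrix transpose_matrix_vector)

lemma symmetric_eigenvectors_orthogonal:
  fixes A :: "real^'n^'n"
  assumes "transpose A = A" "x \<in> eigenspace A \<mu>" "y \<in> eigenspace A \<nu>" "\<mu> \<noteq> \<nu>"
  shows "x \<bullet> y = 0"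
  using symmetric_matrix_inner[OF assms(1), of x y] assms(2-4) by (auto simp: eigenspace_def)

text \<open>Divide by \<open>t\<close> and let \<open>t\<close> tend to \<open>0\<close> from the
  right. This first-order test serves both the Rayleigh quotient and the cubic model.\<close>

lemma linear_coefficient_nonneg:
  fixes b c :: real
  assumes "\<And>t. 0 < t \<Longrightarrow> t < \<delta> \<Longrightarrow> 0 \<le> t * b + t\<^sup>2 * c" "0 < \<delta>"
  shows "0 \<le> b"
proof (rule tendsto_lowerbound)
  show "((\<lambda>t. b + t * c) \<longlongrightarrow> b) (at_right 0)"
    by (auto intro!: tendsto_eq_intros)
  have "0 \<le> b + t * c" if "0 < t" "t < \<delta>" for t
  proof -
    have "0 \<le> t * (b + t * c)"
      using assms(1)[OF that] by (simp add: algebra_simps power2_eq_square)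
    with that show ?thesis by (simp add: zero_le_mult_iff)
  qed
  then show "\<forall>\<^sub>F t in at_right 0. 0 \<le> b + t * c"
    using assms(2) unfolding eventually_at_right_field by blast
qed simp

text \<open>The Rayleigh quotient attains its minimum on the compact unit sphere of
  \<open>S\<close>. By invariance the residual at the minimizer lies in \<open>S\<close>, so it is
  an admissible direction, and minimality forces it to vanish.\<close>

lemma minimal_eigenvector_exists:
  fixes A :: "real^'n^'n" and S :: "(real^'n) set"
  assumes sym: "transpose A = A" and S: "subspace S" "S \<noteq> {0}"
    and inv: "\<And>x. x \<in> S \<Longrightarrow> A *v x \<in> S"
  obtains u \<mu> where "u \<in> S" "u \<noteq> 0" "u \<in> eigenspace A \<mu>"
    "\<And>w. w \<in> S \<Longrightarrow> \<mu> * (w \<bullet> w) \<le> w \<bullet> (A *v w)"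
proof -
  let ?K = "S \<inter> sphere 0 1"
  have unit: "x /\<^sub>R norm x \<in> ?K" if "x \<in> S" "x \<noteq> 0" for x
    using that S by (auto intro: subspace_scale)
  have "compact ?K"
    using closed_Int_compact[OF closed_subspace[OF S(1)]] by auto
  moreover have "?K \<noteq> {}"
    using unit S subspace_0[OF S(1)] by blast
  moreover have "continuous_on ?K (\<lambda>x. x \<bullet> (A *v x))"
    by (intro continuous_intros linear_continuous_on matrix_vector_mul_bounded_linear)
  ultimately obtain u where u: "u \<in> ?K" and min: "\<And>x. x \<in> ?K \<Longrightarrow> u \<bullet> (A *v u) \<le> x \<bullet> (A *v x)"
    using continuous_attains_inf by meson
  have uu: "u \<in> S" "norm u = 1" using u by auto
  define \<mu> where "\<mu> = u \<bullet> (A *v u)"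
  have bound: "\<mu> * (w \<bullet> w) \<le> w \<bullet> (A *v w)" if "w \<in> S" for w
  proof (cases "w = 0")
    case False
    have "\<mu> \<le> (w /\<^sub>R norm w) \<bullet> (A *v (w /\<^sub>R norm w))"
      unfolding \<mu>_def by (rule min[OF unit[OF that False]])
    also have "\<dots> = (w \<bullet> (A *v w)) / (w \<bullet> w)"
      by (simp add: matrix_vector_mult_scaleR dot_square_norm power2_eq_square field_simps)
    finally show ?thesis
      using False by (simp add: field_simps)
  qed simp
  define w where "w = \<mu> *\<^sub>R u - A *v u"
  have w: "w \<in> S"
    unfolding w_def using uu inv S(1) by (intro subspace_diff subspace_scale) auto
  \<comment> \<open>Perturbing \<open>u\<close> in the direction of its negative residual \<open>w\<close> gives \<open>- 2 (w \<bullet> w)\<close> to first order.\<close>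
  have "0 \<le> 2 * (w \<bullet> (A *v u) - \<mu> * (w \<bullet> u))"
  proof (rule linear_coefficient_nonneg[where \<delta> = 1])
    fix t :: real
    have "\<mu> * ((u + t *\<^sub>R w) \<bullet> (u + t *\<^sub>R w)) \<le> (u + t *\<^sub>R w) \<bullet> (A *v (u + t *\<^sub>R w))"
      using uu w S(1) by (intro bound subspace_add subspace_scale)
    moreover have "u \<bullet> (A *v w) = w \<bullet> (A *v u)"
      using symmetric_matrix_inner[OF sym, of u w] by (simp add: inner_commute)
    moreover have "u \<bullet> u = 1"
      using uu by (simp add: dot_square_norm)
    ultimately show "0 \<le> t * (2 * (w \<bullet> (A *v u) - \<mu> * (w \<bullet> u))) + t\<^sup>2 * (w \<bullet> (A *v w) - \<mu> * (w \<bullet> w))"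
      by (simp add: matrix_vector_right_distrib matrix_vector_mult_scaleR inner_add_left
          inner_add_right inner_commute[of u w] \<mu>_def[symmetric] power2_eq_square algebra_simps)
  qed simp
  then have "w \<bullet> w \<le> 0"
    by (simp add: w_def inner_diff_right algebra_simps)
  then have "w = 0"
    by (metis inner_ge_zero inner_eq_zero_iff antisym)
  then have "A *v u = \<mu> *\<^sub>R u"
    by (simp add: w_def)
  moreover have "u \<noteq> 0"
    using uu by auto
  ultimately show thesis
    using that[of u \<mu>] uu bound by (auto simp: eigenspace_def)
qed


section \<open>The negative eigenspace\<close>

text \<open>The union ranges over the spectrum only, hence over finitely many eigenspaces for
  symmetric \<open>A\<close>, so that their dimensions can be summed.\<close>

definition negative_space :: "real^'n::finite^'n \<Rightarrow> (real^'n) set" where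
  "negative_space A = span (\<Union>\<mu>\<in>{\<mu>\<in>real_spectrum A. \<mu> < 0}. eigenspace A \<mu>)"

lemma subspace_negative_space: "subspace (negative_space A)"
  by (simp add: negative_space_def)

lemma eigenspace_subset_negative_space:
  assumes "\<mu> < 0"
  shows "eigenspace A \<mu> \<subseteq> negative_space A"
proof
  fix x assume x: "x \<in> eigenspace A \<mu>"
  show "x \<in> negative_space A"
  \<comment> \<open>The zero vector lies in \<open>eigenspace A \<mu>\<close> even if
    \<open>\<mu>\<close> is not an eigenvalue.\<close>
  proof (cases "x = 0")
    case True
    then show ?thesis by (simp add: negative_space_def span_zero)
  next
    case False
    then have "\<mu> \<in> real_spectrum A" using x by (auto simp: real_spectrum_def)
    then show ?thesis using x assms by (auto simp: negative_space_def intro!: span_base)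
  qed
qed

lemma negative_space_invariant:
  assumes "x \<in> negative_space A"
  shows "A *v x \<in> negative_space A"
  using assms unfolding negative_space_def
proof (induction rule: span_induct_alt)
  case base
  then show ?case by (simp add: span_zero)
next
  case (step c x y)
  then obtain \<mu> where "A *v x = \<mu> *\<^sub>R x" by (auto simp: eigenspace_def)
  then have "A *v (c *\<^sub>R x + y) = (c * \<mu>) *\<^sub>R x + A *v y"
    by (simp add: matrix_vector_right_distrib matrix_vector_mult_scaleR)
  with step show ?case by (auto intro!: span_add span_scale[OF span_base])
qed

lemma eigenspace_orthogonal_negative_space:
  assumes "transpose A = A" "0 \<le> \<nu>" "y \<in> eigenspace A \<nu>" "x \<in> negative_space A"
  shows "y \<bullet> x = 0"
  using assms(4) unfolding negative_space_def
proof (induction rule: span_induct_alt)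
  case (step c x z)
  then have "y \<bullet> x = 0"
    using symmetric_eigenvectors_orthogonal[OF assms(1,3)] assms(2) by fastforce
  with step show ?case by (simp add: inner_add_right)
qed simp

text \<open>Choosing one eigenvector per eigenvalue embeds the spectrum into a pairwise orthogonal
  set, which is finite in finite dimension.\<close>

lemma finite_real_spectrum:
  fixes A :: "real^'n^'n"
  assumes "transpose A = A"
  shows "finite (real_spectrum A)"
proof -
  have "\<forall>\<mu>\<in>real_spectrum A. \<exists>x. x \<noteq> 0 \<and> x \<in> eigenspace A \<mu>"
    by (simp add: real_spectrum_def)
  then obtain e where e: "\<And>\<mu>. \<mu> \<in> real_spectrum A \<Longrightarrow> e \<mu> \<noteq> 0 \<and> e \<mu> \<in> eigenspace A \<mu>"
    by metis
  have orth: "e \<mu> \<bullet> e \<nu> = 0" if "\<mu> \<in> real_spectrum A" "\<nu> \<in> real_spectrum A" "\<mu> \<noteq> \<nu>" for \<mu> \<nu>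
    using that e by (intro symmetric_eigenvectors_orthogonal[OF assms, of _ \<mu> _ \<nu>]) auto
  have "inj_on e (real_spectrum A)"
  proof (rule inj_onI, rule ccontr)
    fix \<mu> \<nu> assume "\<mu> \<in> real_spectrum A" "\<nu> \<in> real_spectrum A" "e \<mu> = e \<nu>" "\<mu> \<noteq> \<nu>"
    then show False using orth[of \<mu> \<nu>] e[of \<nu>] by simp
  qed
  moreover have "pairwise orthogonal (e ` real_spectrum A)"
  proof (rule pairwiseI)
    fix x y assume "x \<in> e ` real_spectrum A" "y \<in> e ` real_spectrum A" "x \<noteq> y"
    then obtain \<mu> \<nu> where "\<mu> \<in> real_spectrum A" "\<nu> \<in> real_spectrum A" "\<mu> \<noteq> \<nu>" "x = e \<mu>" "y = e \<nu>"
      by blast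
    then show "orthogonal x y" using orth by (simp add: orthogonal_def)
  qed
  ultimately show ?thesis
    using finite_imageD pairwise_orthogonal_imp_finite by blast
qed

text \<open>Distinct eigenspaces are orthogonal, so dimensions add; the dimension of the union is
  that of its span.\<close>

lemma dim_Union_eigenspaces:
  fixes A :: "real^'n^'n"
  assumes "transpose A = A" "finite T"
  shows "dim (\<Union>\<mu>\<in>T. eigenspace A \<mu>) = (\<Sum>\<mu>\<in>T. dim (eigenspace A \<mu>))"
  using assms(2)
proof (induction T rule: finite_induct)
  case (insert \<mu> T)
  have "dim (eigenspace A \<mu> \<union> (\<Union>\<mu>\<in>T. eigenspace A \<mu>))
      = dim (eigenspace A \<mu>) + dim (\<Union>\<mu>\<in>T. eigenspace A \<mu>)"
  proof (rule dim_orthogonal_sum)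
    fix x y assume x: "x \<in> eigenspace A \<mu>" and "y \<in> (\<Union>\<mu>\<in>T. eigenspace A \<mu>)"
    then obtain \<nu> where "\<nu> \<in> T" "y \<in> eigenspace A \<nu>" by blast
    with x insert.hyps show "x \<bullet> y = 0"
      by (intro symmetric_eigenvectors_orthogonal[OF assms(1), of x \<mu> y \<nu>]) auto
  qed
  with insert show ?case by simp
qed simp

lemma size_filter_sum_replicate_mset:
  assumes "finite T"
  shows "size {#\<mu> \<in># (\<Sum>\<mu>\<in>T. replicate_mset (d \<mu>) \<mu>). P \<mu>#} = (\<Sum>\<mu>\<in>{\<mu>\<in>T. P \<mu>}. d \<mu>)"
  using assms
proof (induction T rule: finite_induct)
  case (insert \<mu> T)
  moreover have "{\<nu> \<in> insert \<mu> T. P \<nu>} = (if P \<mu> then insert \<mu> {\<nu> \<in> T. P \<nu>} else {\<nu> \<in> T. P \<nu>})"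
    by auto
  moreover have "{#\<nu> \<in># replicate_mset n \<mu>. P \<nu>#} = (if P \<mu> then replicate_mset n \<mu> else {#})" for n
    by (induction n) auto
  ultimately show ?case by simp
qed simp

text \<open>Translates the index from a count with multiplicity into a dimension, the form in which
  it is used below.\<close>

lemma size_negative_eigenvalues:
  fixes A :: "real^'n^'n"
  assumes "transpose A = A"
  shows "size {#\<mu> \<in># eigenvalue_mset A. \<mu> < 0#} = dim (negative_space A)"
  using finite_real_spectrum[OF assms]
  by (simp add: eigenvalue_mset_def size_filter_sum_replicate_mset negative_space_def
      dim_Union_eigenspaces[OF assms])

text \<open>The orthogonal complement \<open>S\<close> is invariant because \<open>A\<close> is
  symmetric. A negative minimal eigenvalue on \<open>S\<close> would have an eigenvector lying in
  both \<open>S\<close> and the negative space, hence orthogonal to itself.\<close>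

lemma quadratic_form_nonneg_orthogonal_negative_space:
  fixes A :: "real^'n^'n"
  assumes sym: "transpose A = A" and w: "\<And>x. x \<in> negative_space A \<Longrightarrow> w \<bullet> x = 0"
  shows "0 \<le> w \<bullet> (A *v w)"
proof -
  define S where "S = {w. \<forall>x\<in>negative_space A. w \<bullet> x = 0}"
  have S: "subspace S"
    by (auto simp: S_def subspace_def inner_add_left)
  have wS: "w \<in> S" using w by (simp add: S_def)
  have inv: "A *v x \<in> S" if "x \<in> S" for x
    using that negative_space_invariant[of _ A] by (auto simp: S_def symmetric_matrix_inner[OF sym])
  show ?thesis
  proof (cases "S = {0}")
    case True
    then show ?thesis using wS by simp
  next
    case False
    obtain u \<mu> where u: "u \<in> S" "u \<noteq> 0" "u \<in> eigenspace A \<mu>"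
      "\<And>w. w \<in> S \<Longrightarrow> \<mu> * (w \<bullet> w) \<le> w \<bullet> (A *v w)"
      using minimal_eigenvector_exists[OF sym S False inv] by blast
    have "0 \<le> \<mu>"
    proof (rule ccontr)
      assume "\<not> 0 \<le> \<mu>"
      then have "u \<in> negative_space A"
        using u(3) eigenspace_subset_negative_space[of \<mu> A] by auto
      then have "u \<bullet> u = 0" using u(1) by (simp add: S_def)
      with u(2) show False by simp
    qed
    then have "0 \<le> \<mu> * (w \<bullet> w)" by simp
    with u(4)[OF wS] show ?thesis by simp
  qed
qed

text \<open>The vectors of the negative space orthogonal to \<open>V\<close> form a subspace that is
  nonzero by dimension count and invariant because \<open>V\<close> consists of eigenvectors; so it
  contains an eigenvector. A nonnegative eigenvalue would make that vector orthogonal to the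
  negative space, and so to itself.\<close>

lemma negative_eigenvector_orthogonal:
  fixes A :: "real^'n^'n"
  assumes sym: "transpose A = A"
    and V: "V \<subseteq> negative_space A" "dim V < dim (negative_space A)"
    and eig: "\<And>x. x \<in> V \<Longrightarrow> \<exists>\<nu>. x \<in> eigenspace A \<nu>"
  obtains u \<mu> where "u \<noteq> 0" "u \<in> eigenspace A \<mu>" "\<mu> < 0" "\<And>x. x \<in> V \<Longrightarrow> x \<bullet> u = 0"
proof -
  define S where "S = {w\<in>negative_space A. \<forall>x\<in>V. x \<bullet> w = 0}"
  have S: "subspace S"
    using subspace_negative_space[of A] by (auto simp: S_def subspace_def inner_add_right)
  have span_neg: "span (negative_space A) = negative_space A"
    by (simp add: negative_space_def)
  have "span V \<subseteq> span (negative_space A)"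
    using V(1) by (rule span_mono)
  moreover have "span V \<noteq> span (negative_space A)"
    using V(2) by (metis dim_span less_irrefl)
  ultimately have "span V \<subset> span (negative_space A)" by blast
  from orthogonal_to_subspace_exists_gen[OF this]
  obtain w where w: "w \<noteq> 0" "w \<in> negative_space A" "\<And>y. y \<in> span V \<Longrightarrow> orthogonal w y"
    unfolding span_neg by blast
  then have "w \<in> S"
    by (auto simp: S_def orthogonal_def span_base inner_commute)
  then have "S \<noteq> {0}" using w(1) by blast
  moreover have "A *v y \<in> S" if "y \<in> S" for y
  proof -
    have "x \<bullet> (A *v y) = 0" if "x \<in> V" for x
      using eig[OF that] \<open>y \<in> S\<close> that symmetric_matrix_inner[OF sym, of x y, symmetric]
      by (auto simp: S_def eigenspace_def)
    then show ?thesis using that negative_space_invariant[of y A] by (simp add: S_def)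
  qed
  ultimately obtain u \<mu> where u: "u \<in> S" "u \<noteq> 0" "u \<in> eigenspace A \<mu>"
    using minimal_eigenvector_exists[OF sym S] by metis
  have "\<mu> < 0"
  proof (rule ccontr)
    assume "\<not> \<mu> < 0"
    then have "u \<bullet> u = 0"
      using u by (intro eigenspace_orthogonal_negative_space[OF sym, of \<mu>]) (auto simp: S_def)
    with u(2) show False by simp
  qed
  with u that show thesis by (auto simp: S_def)
qed

text \<open>In a sorted list, a nonnegative entry at position \<open>i\<close> confines all negative
  entries to the \<open>i\<close> earlier positions, fewer than \<open>k\<close>.\<close>

lemma eigenvalue_list_negative:
  assumes "k \<le> size {#\<mu> \<in># eigenvalue_mset A. \<mu> < 0#}" "i < k"
  shows "eigenvalue_list A ! i < 0"
proof (rule ccontr)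
  let ?l = "eigenvalue_list A"
  assume ge: "\<not> ?l ! i < 0"
  have sorted: "sorted ?l"
    by (simp add: eigenvalue_list_def)
  have "mset ?l = eigenvalue_mset A"
    by (simp add: eigenvalue_list_def)
  then have "size {#\<mu> \<in># eigenvalue_mset A. \<mu> < 0#} = length (filter (\<lambda>\<mu>. \<mu> < 0) ?l)"
    by (metis mset_filter size_mset)
  also have "\<dots> = card {j. j < length ?l \<and> ?l ! j < 0}"
    by (rule length_filter_conv_card)
  also have "\<dots> \<le> card {..<i}"
  proof (rule card_mono)
    show "{j. j < length ?l \<and> ?l ! j < 0} \<subseteq> {..<i}"
    proof
      fix j assume "j \<in> {j. j < length ?l \<and> ?l ! j < 0}"
      then show "j \<in> {..<i}"
        using ge sorted_nth_mono[OF sorted, of i j] by (cases "i \<le> j") auto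
    qed
  qed simp
  finally show False using assms by simp
qed


section \<open>The reflected quadratic model\<close>

lemma reflection_mult:
  "reflection k v *v x = x - (\<Sum>i<k. (2 * (v i \<bullet> x)) *\<^sub>R v i)"
proof -
  have outer: "outer_product u u *v x = (u \<bullet> x) *\<^sub>R u" for u
    by (simp add: vec_eq_iff outer_product_def matrix_vector_mult_def inner_vec_def
        sum_distrib_left mult_ac)
  have "(\<Sum>i<k. M i) *v x = (\<Sum>i<k. M i *v x)" for M :: "nat \<Rightarrow> real^'a^'a"
    by (induction k) (auto simp: matrix_vector_mult_add_rdistrib)
  then show ?thesis
    by (simp add: reflection_def matrix_vector_mult_diff_rdistrib outer
        scaleR_matrix_vector_assoc[symmetric])
qed

text \<open>A vector in the kernel equals twice its projection onto the span of the
  \<open>v i\<close>, so each coefficient \<open>v j \<bullet> x\<close> equals its own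
  double.\<close>

lemma reflection_mult_eq_0:
  assumes orth: "\<And>i j. i < k \<Longrightarrow> j < k \<Longrightarrow> v i \<bullet> v j = (if i = j then 1 else 0)"
    and "reflection k v *v x = 0"
  shows "x = 0"
proof -
  have x: "x = (\<Sum>i<k. (2 * (v i \<bullet> x)) *\<^sub>R v i)"
    using assms(2) by (simp add: reflection_mult)
  have "v j \<bullet> x = 0" if "j < k" for j
  proof -
    have "v j \<bullet> x = v j \<bullet> (\<Sum>i<k. (2 * (v i \<bullet> x)) *\<^sub>R v i)"
      using x by simp
    also have "\<dots> = (\<Sum>i<k. if i = j then 2 * (v i \<bullet> x) else 0)"
      unfolding inner_sum_right using that by (intro sum.cong) (auto simp: orth)
    also have "\<dots> = 2 * (v j \<bullet> x)"
      using that by simp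
    finally show ?thesis by simp
  qed
  then show ?thesis by (subst x) simp
qed

lemma quadratic_form_sym_part:
  fixes A :: "real^'n^'n"
  shows "s \<bullet> (sym_part A *v s) = s \<bullet> (A *v s)"
proof -
  have "s \<bullet> (transpose A *v s) = s \<bullet> (A *v s)"
    by (metis dot_lmul_matrix inner_commute transpose_matrix_vector)
  then show ?thesis
    by (simp add: sym_part_def scaleR_matrix_vector_assoc[symmetric]
        matrix_vector_mult_add_rdistrib inner_add_right)
qed

text \<open>The skew part does not contribute to the form, and symmetry gives
  \<open>v i \<bullet> (A *v s) = \<nu> i * (v i \<bullet> s)\<close>.\<close>

lemma reflected_quadratic_form:
  fixes A :: "real^'n^'n"
  assumes sym: "transpose A = A"
    and eig: "\<And>i. i < k \<Longrightarrow> A *v v i = \<nu> i *\<^sub>R v i"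
  shows "s \<bullet> (sym_part (reflection k v ** A) *v s) = s \<bullet> (A *v s) - (\<Sum>i<k. 2 * \<nu> i * (v i \<bullet> s)\<^sup>2)"
proof -
  have "v i \<bullet> (A *v s) = \<nu> i * (v i \<bullet> s)" if "i < k" for i
    using symmetric_matrix_inner[OF sym, of "v i" s] eig[OF that] by simp
  then have "(\<Sum>i<k. (2 * (v i \<bullet> (A *v s))) *\<^sub>R v i) = (\<Sum>i<k. (2 * (\<nu> i * (v i \<bullet> s))) *\<^sub>R v i)"
    by (intro sum.cong) auto
  then show ?thesis
    by (simp add: quadratic_form_sym_part matrix_vector_mul_assoc[symmetric] reflection_mult
        inner_diff_right inner_sum_right power2_eq_square inner_commute mult_ac)
qed

text \<open>\<open>w s\<close> is the projection of \<open>s\<close> onto the orthogonal complement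
  of the \<open>v i\<close>. Their span is invariant under \<open>A\<close>, so the form splits
  without cross terms.\<close>

lemma orthogonal_part_quadratic_form:
  fixes A :: "real^'n^'n" and v :: "nat \<Rightarrow> real^'n"
  assumes sym: "transpose A = A"
    and orth: "\<And>i j. i < k \<Longrightarrow> j < k \<Longrightarrow> v i \<bullet> v j = (if i = j then 1 else 0)"
    and eig: "\<And>i. i < k \<Longrightarrow> A *v v i = \<nu> i *\<^sub>R v i"
  defines "w \<equiv> \<lambda>s. s - (\<Sum>i<k. (v i \<bullet> s) *\<^sub>R v i)"
  shows "\<And>i. i < k \<Longrightarrow> v i \<bullet> w s = 0"
    and "w s \<bullet> (A *v w s) = s \<bullet> (A *v s) - (\<Sum>i<k. \<nu> i * (v i \<bullet> s)\<^sup>2)"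
proof -
  show vw: "v i \<bullet> w s = 0" if "i < k" for i
  proof -
    have "v i \<bullet> (\<Sum>j<k. (v j \<bullet> s) *\<^sub>R v j) = (\<Sum>j<k. if j = i then v j \<bullet> s else 0)"
      unfolding inner_sum_right using that by (intro sum.cong) (auto simp: orth)
    with that show ?thesis by (simp add: w_def inner_diff_right)
  qed
  have vA: "v i \<bullet> (A *v y) = \<nu> i * (v i \<bullet> y)" if "i < k" for i y
    using symmetric_matrix_inner[OF sym, of "v i" y] eig[OF that] by simp
  \<comment> \<open>Only the left factor is expanded; each subtracted term vanishes since
    \<open>v i \<bullet> (A *v w s)\<close> is a multiple of
    \<open>v i \<bullet> w s\<close>.\<close>
  have "w s \<bullet> (A *v w s) = s \<bullet> (A *v w s) - (\<Sum>i<k. (v i \<bullet> s) * (v i \<bullet> (A *v w s)))"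
    by (subst w_def) (simp add: inner_diff_left inner_sum_left)
  also have "\<dots> = (A *v s) \<bullet> w s"
    using symmetric_matrix_inner[OF sym, of s "w s"] by (simp add: vA vw)
  also have "\<dots> = s \<bullet> (A *v s) - (\<Sum>i<k. (v i \<bullet> s) * (v i \<bullet> (A *v s)))"
    by (simp add: w_def inner_diff_right inner_sum_right inner_commute)
  finally show "w s \<bullet> (A *v w s) = s \<bullet> (A *v s) - (\<Sum>i<k. \<nu> i * (v i \<bullet> s)\<^sup>2)"
    by (simp add: vA power2_eq_square mult_ac)
qed

text \<open>Along a ray the three terms scale like \<open>t\<close>, \<open>t\<^sup>2\<close> and
  \<open>t ^ 3\<close>, so the linear coefficient and, once it vanishes, the quadratic one must be
  nonnegative.\<close>

lemma cubic_minimum_at_0_iff: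
  fixes r :: "real^'n" and B :: "real^'n^'n"
  assumes "\<sigma> \<ge> 0"
  shows "(\<forall>s. 0 \<le> r \<bullet> s + 1/2 * (s \<bullet> (B *v s)) + \<sigma>/3 * norm s ^ 3)
    \<longleftrightarrow> r = 0 \<and> (\<forall>s. 0 \<le> s \<bullet> (B *v s))" (is "?L \<longleftrightarrow> ?R")
proof
  assume L: ?L
  have scaled: "0 \<le> t * (r \<bullet> s) + t\<^sup>2 * (1/2 * (s \<bullet> (B *v s)) + t * (\<sigma>/3 * norm s ^ 3))"
    if "0 < t" for t s
    using L[rule_format, of "t *\<^sub>R s"] that
    by (simp add: matrix_vector_mult_scaleR power_mult_distrib power2_eq_square power3_eq_cube
        algebra_simps)
  have r: "r = 0"
  proof -
    \<comment> \<open>Test in the direction of steepest descent. For \<open>t < 1\<close> the cubic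
      term is absorbed into the coefficient of \<open>t\<^sup>2\<close>.\<close>
    have "0 \<le> r \<bullet> (- r)"
    proof (rule linear_coefficient_nonneg[where \<delta> = 1])
      fix t :: real assume t: "0 < t" "t < 1"
      have "t * (\<sigma>/3 * norm (- r) ^ 3) \<le> \<sigma>/3 * norm (- r) ^ 3"
        using t assms by (intro mult_left_le_one_le) auto
      then have "t\<^sup>2 * (1/2 * (- r \<bullet> (B *v (- r))) + t * (\<sigma>/3 * norm (- r) ^ 3))
          \<le> t\<^sup>2 * (1/2 * (- r \<bullet> (B *v (- r))) + \<sigma>/3 * norm (- r) ^ 3)"
        by (intro mult_left_mono) auto
      with scaled[OF t(1), of "- r"]
      show "0 \<le> t * (r \<bullet> (- r)) + t\<^sup>2 * (1/2 * (- r \<bullet> (B *v (- r))) + \<sigma>/3 * norm (- r) ^ 3)"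
        by linarith
    qed simp
    then have "r \<bullet> r = 0" using inner_ge_zero[of r] by simp
    then show ?thesis by simp
  qed
  have "0 \<le> s \<bullet> (B *v s)" for s
  proof -
    \<comment> \<open>With \<open>r = 0\<close> one factor \<open>t\<close> cancels, so the
      quadratic term becomes the linear coefficient and the cubic term the quadratic one.\<close>
    have "0 \<le> 1/2 * (s \<bullet> (B *v s))"
    proof (rule linear_coefficient_nonneg[where \<delta> = 1])
      fix t :: real assume t: "0 < t" "t < 1"
      have "0 \<le> t * (t * (1/2 * (s \<bullet> (B *v s))) + t\<^sup>2 * (\<sigma>/3 * norm s ^ 3))"
        using scaled[OF t(1), of s] r by (simp add: power2_eq_square algebra_simps)
      with t show "0 \<le> t * (1/2 * (s \<bullet> (B *v s))) + t\<^sup>2 * (\<sigma>/3 * norm s ^ 3)"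
        by (simp add: zero_le_mult_iff)
    qed simp
    then show ?thesis by simp
  qed
  with r show ?R by simp
next
  assume ?R
  with assms show ?L by simp
qed

lemma reflected_form_psd_iff:
  fixes A :: "real^'n^'n"
  assumes sym: "transpose A = A" and inv: "invertible A"
    and v: "smallest_orthonormal_eigenvectors A k v"
  shows "(\<forall>s. 0 \<le> s \<bullet> (sym_part (reflection k v ** A) *v s))
    \<longleftrightarrow> size {#\<mu> \<in># eigenvalue_mset A. \<mu> < 0#} = k" (is "?psd \<longleftrightarrow> _")
proof -
  define \<nu> where "\<nu> i = eigenvalue_list A ! i" for i
  define V where "V = v ` {..<k}"
  have orth: "v i \<bullet> v j = (if i = j then 1 else 0)" if "i < k" "j < k" for i j
    using v that by (simp add: smallest_orthonormal_eigenvectors_def)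
  have eig: "A *v v i = \<nu> i *\<^sub>R v i" if "i < k" for i
    using v that by (simp add: smallest_orthonormal_eigenvectors_def \<nu>_def)
  have "inj_on v {..<k}"
    using orth by (metis inj_onI lessThan_iff zero_neq_one)
  then have card_V: "card V = k"
    by (simp add: V_def card_image)
  have indep_V: "independent V"
  proof (rule pairwise_orthogonal_independent)
    show "pairwise orthogonal V"
      using orth by (auto simp: pairwise_def orthogonal_def V_def)
    show "0 \<notin> V"
      using orth by (force simp: V_def)
  qed
  have V_neg: "V \<subseteq> negative_space A" if "\<And>i. i < k \<Longrightarrow> \<nu> i < 0"
    using that eig eigenspace_subset_negative_space by (fastforce simp: V_def eigenspace_def)
  have "?psd \<longleftrightarrow> dim (negative_space A) = k"
  proof
    assume psd: ?psd
    have neg: "\<nu> i < 0" if "i < k" for i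
    proof -
      have vi: "v i \<bullet> v i = 1" using orth that by simp
      \<comment> \<open>Testing the form on \<open>v i\<close> itself gives
        \<open>\<nu> i - 2 * \<nu> i\<close>; invertibility then excludes a zero eigenvalue.\<close>
      have "(\<Sum>j<k. 2 * \<nu> j * (v j \<bullet> v i)\<^sup>2) = (\<Sum>j<k. if j = i then 2 * \<nu> j else 0)"
        using that by (intro sum.cong) (auto simp: orth)
      then have "v i \<bullet> (sym_part (reflection k v ** A) *v v i) = - \<nu> i"
        using that by (simp add: reflected_quadratic_form[OF sym eig] eig vi)
      then have "\<nu> i \<le> 0" using psd by (metis neg_0_le_iff_le)
      moreover have "\<nu> i \<noteq> 0"
      proof
        assume "\<nu> i = 0"
        then have "A *v v i = 0" using eig[OF that] by simp
        then have "v i = 0"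
          using inv by (metis inj_matrix_vector_mult injD matrix_vector_mult_0_right)
        with vi show False by simp
      qed
      ultimately show ?thesis by simp
    qed
    have "k \<le> dim (negative_space A)"
      using independent_card_le_dim[OF V_neg indep_V] neg card_V by simp
    \<comment> \<open>Otherwise some negative eigenvector \<open>u\<close> is orthogonal to every
      \<open>v i\<close>; the correction sum vanishes on it and the form stays negative.\<close>
    moreover have "\<not> k < dim (negative_space A)"
    proof
      assume "k < dim (negative_space A)"
      then have "dim V < dim (negative_space A)"
        using indep_V card_V by (simp add: dim_eq_card_independent)
      moreover have "\<exists>\<nu>. x \<in> eigenspace A \<nu>" if "x \<in> V" for x
        using that eig by (auto simp: V_def eigenspace_def)
      ultimately obtain u \<mu> where u: "u \<noteq> 0" "u \<in> eigenspace A \<mu>" "\<mu> < 0"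
        "\<And>x. x \<in> V \<Longrightarrow> x \<bullet> u = 0"
        using negative_eigenvector_orthogonal[OF sym V_neg] neg by metis
      then have "u \<bullet> (sym_part (reflection k v ** A) *v u) = \<mu> * (u \<bullet> u)"
        by (simp add: reflected_quadratic_form[OF sym eig] V_def eigenspace_def)
      moreover have "\<mu> * (u \<bullet> u) < 0"
        using u by (simp add: mult_neg_pos)
      ultimately show False using psd by (metis not_le)
    qed
    ultimately show "dim (negative_space A) = k" by simp
  next
    assume dim: "dim (negative_space A) = k"
    have neg: "\<nu> i < 0" if "i < k" for i
      unfolding \<nu>_def
      by (rule eigenvalue_list_negative[OF _ that]) (simp add: size_negative_eigenvalues[OF sym] dim)
    \<comment> \<open>\<open>k\<close> independent vectors in a space of dimension \<open>k\<close>
      span it, so \<open>w\<close> below is orthogonal to the whole negative space.\<close>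
    have span_V: "negative_space A \<subseteq> span V"
      using card_eq_dim[OF V_neg] neg card_V dim indep_V by (simp add: V_def)
    show ?psd
    proof
      fix s
      define w where "w = s - (\<Sum>i<k. (v i \<bullet> s) *\<^sub>R v i)"
      note w = orthogonal_part_quadratic_form[where k = k and v = v and s = s, OF sym orth eig, folded w_def]
      have "w \<bullet> x = 0" if "x \<in> negative_space A" for x
      proof -
        have "orthogonal w x"
          using that span_V w(1)
          by (intro orthogonal_to_span[of x V]) (auto simp: V_def orthogonal_def inner_commute)
        then show ?thesis by (simp add: orthogonal_def)
      qed
      then have "0 \<le> w \<bullet> (A *v w)"
        by (rule quadratic_form_nonneg_orthogonal_negative_space[OF sym])
      moreover have "(\<Sum>i<k. \<nu> i * (v i \<bullet> s)\<^sup>2) \<le> 0"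
        using neg by (intro sum_nonpos mult_nonpos_nonneg) (auto intro: less_imp_le)
      moreover have "(\<Sum>i<k. 2 * \<nu> i * (v i \<bullet> s)\<^sup>2) = 2 * (\<Sum>i<k. \<nu> i * (v i \<bullet> s)\<^sup>2)"
        by (simp add: sum_distrib_left mult_ac)
      \<comment> \<open>The form at \<open>s\<close> equals \<open>w \<bullet> (A *v w)\<close>
        minus the nonpositive sum: the split adds that sum once and the reflection subtracts it
        twice.\<close>
      ultimately show "0 \<le> s \<bullet> (sym_part (reflection k v ** A) *v s)"
        using w(2) by (simp add: reflected_quadratic_form[OF sym eig])
    qed
  qed
  then show ?thesis
    by (simp add: size_negative_eigenvalues[OF sym])
qed

theorem proposition2p4:
  fixes f :: "real^'n \<Rightarrow> real" and k :: nat and \<sigma> :: real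
    and xbar :: "real^'n" and v :: "nat \<Rightarrow> real^'n"
  assumes "CARD('n) \<ge> 2"
    and "C_k 3 f"
    and "k \<le> CARD('n)"
    and "\<And>x. critical_point f x \<Longrightarrow> nondegenerate f x"
    and "\<sigma> > 0"
    and "smallest_orthonormal_eigenvectors (hessian f xbar) k v"
  shows "cubic_reg_fixed_point k \<sigma> v f xbar \<longleftrightarrow> index_critical_point k f xbar"
proof -
  let ?r = "reflection k v *v gradient f xbar"
    and ?B = "sym_part (reflection k v ** hessian f xbar)"
  \<comment> \<open>Second partial derivatives are differentiable, hence continuous.\<close>
  have "C_k 2 f"
    using assms(2) by (auto simp: numeral_2_eq_2 numeral_3_eq_3 differentiable_imp_continuous_on
        differentiable_on_def differentiable_at_withinI)
  then have sym: "transpose (hessian f xbar) = hessian f xbar"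
    by (rule hessian_symmetric)
  have "cubic_reg_fixed_point k \<sigma> v f xbar \<longleftrightarrow>
      (\<forall>s. 0 \<le> ?r \<bullet> s + 1/2 * (s \<bullet> (?B *v s)) + \<sigma>/3 * norm s ^ 3)"
    by (simp add: cubic_reg_fixed_point_def is_arg_min_def cubic_model_def Let_def not_less add.assoc)
  also have "\<dots> \<longleftrightarrow> ?r = 0 \<and> (\<forall>s. 0 \<le> s \<bullet> (?B *v s))"
    using assms(5) by (intro cubic_minimum_at_0_iff) simp
  also have "?r = 0 \<longleftrightarrow> critical_point f xbar"
    using assms(6) reflection_mult_eq_0[of k v "gradient f xbar"]
    by (auto simp: critical_point_def smallest_orthonormal_eigenvectors_def)
  \<comment> \<open>Invertibility of the Hessian is known only at critical points, so the
    semidefiniteness criterion is applied under that conjunct.\<close>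
  also have "critical_point f xbar \<and> (\<forall>s. 0 \<le> s \<bullet> (?B *v s)) \<longleftrightarrow> index_critical_point k f xbar"
    using assms(4) reflected_form_psd_iff[OF sym _ assms(6)]
    by (auto simp: index_critical_point_def nondegenerate_def)
  finally show ?thesis .
qed

end
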